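(* In the setting described in the context, assume (A1). Let $u_M$ and $u$ denote respectively the solutions of the monotone scheme $u_M^{n+1}=S_M(u_M^n)$ and of the filtered scheme $u^{n+1}=S_F(u^n,u^{n-1})$. (i) There is a constant $C\ge0$ (independent of $\tau,\Delta x$) such that $$\max_{0\le n\le N}\|u^n-u_M^n\|_\infty\le Te^{CT}\varepsilon .$$ (ii) In particular, if the solution $u_M$ of the monotone scheme converges to the viscosity solution $v$ of the HJB equation as $(\tau,\Delta x)\to0$ (i.e. $\max_{0\le n\le N}\|u_M^n-v^n\|_\infty\to0$, where $v^n:=(v(t_n,x_i))_{i\in\mathbb I}$), then so does the solution $u$ of the filtered scheme.
   Context: **Equation.** $T>0$, $A\subset\mathbb R^m$ is nonempty and compact, and $v$ is the viscosity solution of $$v_t+\sup_{a\in A}\Big\{-\tfrac12\sigma^2(t,x,a)v_{xx}+b(t,x,a)v_x+f(t,x,a)v+\ell(t,x,a)\Big\}=0\ \text{ on }(0,T)\times\mathbb R,\qquad v(0,x)=v_0(x).$$ $v_0$ is bounded and Lipschitz; $\sigma,b,f,\ell$ are bounded, Lipschitz in $x$ and $1/2$-Hölder in $t$, uniformly in $a\in A$. **Grids.** $\tau=T/N$ ($N\ge1$ an integer), $t_n=n\tau$; $\Delta x>0$, $x_i=i\Delta x$ for $i$ in a finite index set $\mathbb I$ with $J$ elements (depending on $\Delta x$). The pairs $(\tau,\Delta x)$ range over a fixed family of discretization parameters accumulating at $(0,0)$. $\|\cdot\|_\infty$ on $\mathbb R^J$ is the max norm, and on matrices the induced norm. Inequalities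 between vectors and suprema of vectors are componentwise. **Monotone scheme.** For each $a\in A$ and each $n$ there are given $M^{a,n}\in\mathbb R^{J\times J}$ ($n\ge1$) and $G^{a,n}:\mathbb R^J\to\mathbb R^J$ ($n\ge0$). For $a=(a_i)_{i\in\mathbb I}\in A^J$ put $(M^{a,n})_{ij}:=(M^{a_i,n})_{ij}$ and $(G^{a,n}(u))_i:=(G^{a_i,n}(u))_i$. For $\phi\in\mathbb R^J$, $S_M(\phi)$ (at step $n$; dependence on $n$ suppressed) is the unique $w\in\mathbb R^J$ with $\sup_{a\in A^J}\{M^{a,n+1}w-G^{a,n}(\phi)\}=0$ (it exists and is unique under (A1)). The monotone scheme is $u_M^0=(v_0(x_i))_i$, $u_M^{n+1}=S_M(u_M^n)$. **(A1)** (i) For all $a\in A^J$, $n\ge1$, $M^{a,n}$ is an M-matrix: off-diagonal entries are $\le0$, it is invertible and $(M^{a,n})^{-1}\ge0$ entrywise. (ii) For all $n\ge1$ and all $(\tau,\Delta x)$ there is $C_n=C_n(\tau,\Delta x)$ with $\sup_{a\in A^J}\|M^{a,n}\|_\infty\le C_n$. (iii) There is $C>0$ independent of $n,\tau,\Delta x$ with $\sup_{a\in A^J}\|(M^{a,n})^{-1}\|_\infty\le1+C\tau$ for all $n\ge1$. (iv) For all $a\in A^J$, $n\ge0$: $\varphi\le\psi\Rightarrow G^{a,n}(\varphi)\le G^{a,n}(\psi)$. (v) There is $C>0$ independent of $n,\tau,\Delta x$ such that for all $a\in A^J$, $n\ge0$, $\varphi,\psi\in\mathbb R^J$: $\|G^{a,n}(\varphi)-G^{a,n}(\psi)\|_\infty\le(1+C\tau)\|\varphi-\psi\|_\infty$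 and $\|G^{a,n}(0)\|_\infty\le C\tau$. **High order scheme.** Arbitrary maps $S_H:\mathbb R^J\times\mathbb R^J\to\mathbb R^J$ (possibly depending on $n,\tau,\Delta x$) and a starting map $S_{H,0}:\mathbb R^J\to\mathbb R^J$ for the first step. **Filtered scheme.** $F(y):=y$ if $|y|\le1$ and $F(y):=0$ otherwise. With $\varepsilon=\varepsilon_{\tau,\Delta x}>0$, $\varepsilon_{\tau,\Delta x}\to0$ as $(\tau,\Delta x)\to0$, put for $n\ge1$ $$u_i^{n+1}=S_F(u^n,u^{n-1})_i:=S_M(u^n)_i+\varepsilon\tau F\Big(\frac{S_H(u^n,u^{n-1})_i-S_M(u^n)_i}{\varepsilon\tau}\Big),$$ with $u^0_i=v_0(x_i)$, and $u^1$ given by the same formula with $S_{H,0}(u^0)$ in place of $S_H(u^n,u^{n-1})$. *)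

theory Defs
  imports "HOL-Analysis.Analysis"
begin

text \<open>Since the number of grid points varies with the mesh size, a vector of \<open>\<real>\<^sup>J\<close> is an
  extensional function on a finite index set \<open>I\<close>, i.e. an element of \<open>I \<rightarrow>\<^sub>E UNIV\<close>, and a
  matrix is a function \<open>int \<Rightarrow> int \<Rightarrow> real\<close> of which only the entries in \<open>I \<times> I\<close> matter.\<close>

type_synonym gvec = "int \<Rightarrow> real"
type_synonym gmat = "int \<Rightarrow> int \<Rightarrow> real"

abbreviation gvecs :: "int set \<Rightarrow> gvec set" where
  "gvecs I \<equiv> I \<rightarrow>\<^sub>E UNIV"

text \<open>The element \<open>0\<close> is inserted only to cover \<open>I = {}\<close>.\<close>
definition vnorm :: "int set \<Rightarrow> gvec \<Rightarrow> real" where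
  "vnorm I u = Max (insert 0 ((\<lambda>i. \<bar>u i\<bar>) ` I))"

definition mat_vec :: "int set \<Rightarrow> gmat \<Rightarrow> gvec \<Rightarrow> gvec" where
  "mat_vec I B u = (\<lambda>i\<in>I. \<Sum>j\<in>I. B i j * u j)"

definition mnorm :: "int set \<Rightarrow> gmat \<Rightarrow> real" where
  "mnorm I B = (SUP u\<in>{u \<in> gvecs I. vnorm I u \<le> 1}. vnorm I (mat_vec I B u))"

definition is_inverse :: "int set \<Rightarrow> gmat \<Rightarrow> gmat \<Rightarrow> bool" where
  "is_inverse I B D \<longleftrightarrow> (\<forall>i\<in>I. \<forall>j\<in>I.
     (\<Sum>k\<in>I. B i k * D k j) = (if i = j then 1 else 0) \<and>
     (\<Sum>k\<in>I. D i k * B k j) = (if i = j then 1 else 0))"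

definition is_M_matrix :: "int set \<Rightarrow> gmat \<Rightarrow> bool" where
  "is_M_matrix I B \<longleftrightarrow>
     (\<forall>i\<in>I. \<forall>j\<in>I. i \<noteq> j \<longrightarrow> B i j \<le> 0) \<and>
     (\<exists>D. is_inverse I B D \<and> (\<forall>i\<in>I. \<forall>j\<in>I. 0 \<le> D i j))"


subsection \<open>The HJB equation and its viscosity solutions\<close>

definition regular_coeff ::
  "real \<Rightarrow> 'a set \<Rightarrow> (real \<Rightarrow> real \<Rightarrow> 'a \<Rightarrow> real) \<Rightarrow> bool" where
  "regular_coeff T A g \<longleftrightarrow>
     (\<exists>K. \<forall>t\<in>{0..T}. \<forall>x. \<forall>a\<in>A. \<bar>g t x a\<bar> \<le> K) \<and>
     (\<exists>L. \<forall>t\<in>{0..T}. \<forall>a\<in>A. L-lipschitz_on UNIV (\<lambda>x. g t x a)) \<and>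
     (\<exists>K. \<forall>s\<in>{0..T}. \<forall>t\<in>{0..T}. \<forall>x. \<forall>a\<in>A. \<bar>g s x a - g t x a\<bar> \<le> K * sqrt \<bar>s - t\<bar>)"

text \<open>For coefficients as in \<open>regular_coeff\<close> the supremum is over a bounded set.\<close>
definition hamiltonian ::
  "'a set \<Rightarrow> (real \<Rightarrow> real \<Rightarrow> 'a \<Rightarrow> real) \<Rightarrow> (real \<Rightarrow> real \<Rightarrow> 'a \<Rightarrow> real) \<Rightarrow>
   (real \<Rightarrow> real \<Rightarrow> 'a \<Rightarrow> real) \<Rightarrow> (real \<Rightarrow> real \<Rightarrow> 'a \<Rightarrow> real) \<Rightarrow>
   real \<Rightarrow> real \<Rightarrow> real \<Rightarrow> real \<Rightarrow> real \<Rightarrow> real" where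
  "hamiltonian A \<sigma> b f l t x r p X =
     (SUP a\<in>A. - (1/2) * (\<sigma> t x a)\<^sup>2 * X + b t x a * p + f t x a * r + l t x a)"

definition C12_test_function ::
  "real \<Rightarrow> (real \<Rightarrow> real \<Rightarrow> real) \<Rightarrow> (real \<Rightarrow> real \<Rightarrow> real) \<Rightarrow>
   (real \<Rightarrow> real \<Rightarrow> real) \<Rightarrow> (real \<Rightarrow> real \<Rightarrow> real) \<Rightarrow> bool" where
  "C12_test_function T \<phi> \<phi>t \<phi>x \<phi>xx \<longleftrightarrow>
     (\<forall>t\<in>{0<..<T}. \<forall>x.
        ((\<lambda>s. \<phi> s x) has_real_derivative \<phi>t t x) (at t) \<and>
        ((\<lambda>y. \<phi> t y) has_real_derivative \<phi>x t x) (at x) \<and>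
        ((\<lambda>y. \<phi>x t y) has_real_derivative \<phi>xx t x) (at x)) \<and>
     (\<forall>g\<in>{\<phi>, \<phi>t, \<phi>x, \<phi>xx}. continuous_on ({0<..<T} \<times> UNIV) (\<lambda>(t, x). g t x))"

definition viscosity_solution ::
  "real \<Rightarrow> 'a set \<Rightarrow> (real \<Rightarrow> real \<Rightarrow> 'a \<Rightarrow> real) \<Rightarrow> (real \<Rightarrow> real \<Rightarrow> 'a \<Rightarrow> real) \<Rightarrow>
   (real \<Rightarrow> real \<Rightarrow> 'a \<Rightarrow> real) \<Rightarrow> (real \<Rightarrow> real \<Rightarrow> 'a \<Rightarrow> real) \<Rightarrow>
   (real \<Rightarrow> real) \<Rightarrow> (real \<Rightarrow> real \<Rightarrow> real) \<Rightarrow> bool" where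
  "viscosity_solution T A \<sigma> b f l v0 v \<longleftrightarrow>
     continuous_on ({0..T} \<times> UNIV) (\<lambda>(t, x). v t x) \<and>
     (\<forall>x. v 0 x = v0 x) \<and>
     (\<forall>\<phi> \<phi>t \<phi>x \<phi>xx. C12_test_function T \<phi> \<phi>t \<phi>x \<phi>xx \<longrightarrow> (\<forall>t\<in>{0<..<T}. \<forall>x.
        ((\<forall>\<^sub>F (s, y) in nhds (t, x). v s y - \<phi> s y \<le> v t x - \<phi> t x) \<longrightarrow>
           \<phi>t t x + hamiltonian A \<sigma> b f l t x (v t x) (\<phi>x t x) (\<phi>xx t x) \<le> 0) \<and>
        ((\<forall>\<^sub>F (s, y) in nhds (t, x). v s y - \<phi> s y \<ge> v t x - \<phi> t x) \<longrightarrow>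
           \<phi>t t x + hamiltonian A \<sigma> b f l t x (v t x) (\<phi>x t x) (\<phi>xx t x) \<ge> 0)))"


subsection \<open>Discretization parameters\<close>

text \<open>A family of pairs \<open>(\<tau>, h)\<close>, where \<open>h\<close> stands for \<open>\<Delta>x\<close>.\<close>
definition discretization_family :: "real \<Rightarrow> (real \<times> real) set \<Rightarrow> bool" where
  "discretization_family T P \<longleftrightarrow>
     (\<forall>(\<tau>, h)\<in>P. (\<exists>N::nat. N \<ge> 1 \<and> \<tau> = T / real N) \<and> h > 0) \<and> (0, 0) islimpt P"

text \<open>The integer \<open>N\<close> with \<open>\<tau> = T / N\<close>.\<close>
definition nsteps :: "real \<Rightarrow> real \<Rightarrow> nat" where
  "nsteps T \<tau> = nat \<lfloor>T / \<tau>\<rfloor>"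

definition max_error ::
  "real \<Rightarrow> real \<Rightarrow> int set \<Rightarrow> (nat \<Rightarrow> gvec) \<Rightarrow> (nat \<Rightarrow> gvec) \<Rightarrow> real" where
  "max_error T \<tau> I u w = (MAX n\<in>{0..nsteps T \<tau>}. vnorm I (\<lambda>i\<in>I. u n i - w n i))"

definition grid_values :: "int set \<Rightarrow> real \<Rightarrow> (real \<Rightarrow> real) \<Rightarrow> gvec" where
  "grid_values I h g = (\<lambda>i\<in>I. g (of_int i * h))"


subsection \<open>The monotone scheme\<close>

definition policy_mat :: "('a \<Rightarrow> nat \<Rightarrow> gmat) \<Rightarrow> (int \<Rightarrow> 'a) \<Rightarrow> nat \<Rightarrow> gmat" where
  "policy_mat M a n = (\<lambda>i j. M (a i) n i j)"

definition policy_map ::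
  "int set \<Rightarrow> ('a \<Rightarrow> nat \<Rightarrow> gvec \<Rightarrow> gvec) \<Rightarrow> (int \<Rightarrow> 'a) \<Rightarrow> nat \<Rightarrow> gvec \<Rightarrow> gvec" where
  "policy_map I G a n u = (\<lambda>i\<in>I. G (a i) n u i)"

definition assumption_A1 ::
  "(real \<times> real) set \<Rightarrow> (real \<Rightarrow> int set) \<Rightarrow> 'a set \<Rightarrow>
   (real \<Rightarrow> real \<Rightarrow> 'a \<Rightarrow> nat \<Rightarrow> gmat) \<Rightarrow> (real \<Rightarrow> real \<Rightarrow> 'a \<Rightarrow> nat \<Rightarrow> gvec \<Rightarrow> gvec) \<Rightarrow> bool" where
  "assumption_A1 P I A M G \<longleftrightarrow>
     (\<forall>(\<tau>, h)\<in>P. \<forall>a \<in> I h \<rightarrow>\<^sub>E A. \<forall>n\<ge>1. is_M_matrix (I h) (policy_mat (M \<tau> h) a n)) \<and>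
     (\<forall>(\<tau>, h)\<in>P. \<forall>n\<ge>1. \<exists>C. \<forall>a \<in> I h \<rightarrow>\<^sub>E A. mnorm (I h) (policy_mat (M \<tau> h) a n) \<le> C) \<and>
     (\<exists>C>0. \<forall>(\<tau>, h)\<in>P. \<forall>n\<ge>1. \<forall>a \<in> I h \<rightarrow>\<^sub>E A. \<forall>D.
        is_inverse (I h) (policy_mat (M \<tau> h) a n) D \<longrightarrow> mnorm (I h) D \<le> 1 + C * \<tau>) \<and>
     (\<forall>(\<tau>, h)\<in>P. \<forall>a \<in> I h \<rightarrow>\<^sub>E A. \<forall>n. \<forall>\<phi>\<in>gvecs (I h). \<forall>\<psi>\<in>gvecs (I h).
        (\<forall>i\<in>I h. \<phi> i \<le> \<psi> i) \<longrightarrow>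
        (\<forall>i\<in>I h. policy_map (I h) (G \<tau> h) a n \<phi> i \<le> policy_map (I h) (G \<tau> h) a n \<psi> i)) \<and>
     (\<exists>C>0. \<forall>(\<tau>, h)\<in>P. \<forall>a \<in> I h \<rightarrow>\<^sub>E A. \<forall>n.
        (\<forall>\<phi>\<in>gvecs (I h). \<forall>\<psi>\<in>gvecs (I h).
           vnorm (I h) (\<lambda>i\<in>I h. policy_map (I h) (G \<tau> h) a n \<phi> i
                                - policy_map (I h) (G \<tau> h) a n \<psi> i)
             \<le> (1 + C * \<tau>) * vnorm (I h) (\<lambda>i\<in>I h. \<phi> i - \<psi> i)) \<and>
        vnorm (I h) (policy_map (I h) (G \<tau> h) a n (\<lambda>i\<in>I h. 0)) \<le> C * \<tau>)"

text \<open>Under \<open>assumption_A1\<close> each componentwise supremum is over a bounded set of reals, and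
  the vector \<open>w\<close> exists and is unique.\<close>
definition S_M ::
  "int set \<Rightarrow> 'a set \<Rightarrow> ('a \<Rightarrow> nat \<Rightarrow> gmat) \<Rightarrow> ('a \<Rightarrow> nat \<Rightarrow> gvec \<Rightarrow> gvec) \<Rightarrow>
   nat \<Rightarrow> gvec \<Rightarrow> gvec" where
  "S_M I A M G n \<phi> = (THE w. w \<in> gvecs I \<and>
     (\<forall>i\<in>I. (SUP a \<in> I \<rightarrow>\<^sub>E A.
        mat_vec I (policy_mat M a (n + 1)) w i - policy_map I G a n \<phi> i) = 0))"

primrec monotone_sol ::
  "int set \<Rightarrow> 'a set \<Rightarrow> ('a \<Rightarrow> nat \<Rightarrow> gmat) \<Rightarrow> ('a \<Rightarrow> nat \<Rightarrow> gvec \<Rightarrow> gvec) \<Rightarrow>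
   gvec \<Rightarrow> nat \<Rightarrow> gvec" where
  "monotone_sol I A M G u0 0 = u0"
| "monotone_sol I A M G u0 (Suc n) = S_M I A M G n (monotone_sol I A M G u0 n)"


subsection \<open>The filtered scheme\<close>

definition filter_fun :: "real \<Rightarrow> real" where
  "filter_fun y = (if \<bar>y\<bar> \<le> 1 then y else 0)"

definition filter_combine :: "int set \<Rightarrow> real \<Rightarrow> real \<Rightarrow> gvec \<Rightarrow> gvec \<Rightarrow> gvec" where
  "filter_combine I \<epsilon> \<tau> wM wH =
     (\<lambda>i\<in>I. wM i + \<epsilon> * \<tau> * filter_fun ((wH i - wM i) / (\<epsilon> * \<tau>)))"

fun filtered_sol ::
  "int set \<Rightarrow> 'a set \<Rightarrow> ('a \<Rightarrow> nat \<Rightarrow> gmat) \<Rightarrow> ('a \<Rightarrow> nat \<Rightarrow> gvec \<Rightarrow> gvec) \<Rightarrow>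
   (nat \<Rightarrow> gvec \<Rightarrow> gvec \<Rightarrow> gvec) \<Rightarrow> (gvec \<Rightarrow> gvec) \<Rightarrow> real \<Rightarrow> real \<Rightarrow>
   gvec \<Rightarrow> nat \<Rightarrow> gvec" where
  "filtered_sol I A M G SH SH0 \<epsilon> \<tau> u0 0 = u0"
| "filtered_sol I A M G SH SH0 \<epsilon> \<tau> u0 (Suc 0) =
     filter_combine I \<epsilon> \<tau> (S_M I A M G 0 u0) (SH0 u0)"
| "filtered_sol I A M G SH SH0 \<epsilon> \<tau> u0 (Suc (Suc n)) =
     filter_combine I \<epsilon> \<tau>
       (S_M I A M G (Suc n) (filtered_sol I A M G SH SH0 \<epsilon> \<tau> u0 (Suc n)))
       (SH (Suc n) (filtered_sol I A M G SH SH0 \<epsilon> \<tau> u0 (Suc n))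
                   (filtered_sol I A M G SH SH0 \<epsilon> \<tau> u0 n))"

end

(* The residual of the nonlinear system, res(w) = sup over a of (M a w - g a), satisfies a
   comparison principle: choosing the policy row by row almost optimally for z gives
   M a (w - z) \<le> res(w) - res(z) + \<eta>, and the inverse of M a is nonnegative with norm at most
   K. Hence solutions are unique and depend on g with Lipschitz constant K. Existence follows as in
   the Knaster--Tarski theorem: the damped map w - res(w) / C is monotone when C bounds the entries
   of all M a, since off-diagonal entries are nonpositive, and the infimum of all w with
   res(w) \<ge> 0 is a fixed point of it. So S_M is Lipschitz with constant (1 + C1 \<tau>) (1 + C2 \<tau>),
   the filter perturbs each step by at most \<epsilon> \<tau>, and the error bound is a discrete Gronwall
   estimate. *)

theory Submission
  imports Defs
begin

section \<open>The maximum norm and the induced matrix norm\<close>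

lemma vnorm_le_iff:
  assumes "finite I" "0 \<le> c"
  shows "vnorm I u \<le> c \<longleftrightarrow> (\<forall>i\<in>I. \<bar>u i\<bar> \<le> c)"
  using assms by (simp add: vnorm_def)

lemma vnorm_nonneg:
  assumes "finite I"
  shows "0 \<le> vnorm I u"
  using assms by (simp add: vnorm_def)

lemma abs_le_vnorm:
  assumes "finite I" "i \<in> I"
  shows "\<bar>u i\<bar> \<le> vnorm I u"
  using assms by (simp add: vnorm_def)

lemma vnorm_triangle_diff:
  assumes "finite I"
  shows "vnorm I (\<lambda>i\<in>I. u i - w i) \<le> vnorm I (\<lambda>i\<in>I. u i - z i) + vnorm I (\<lambda>i\<in>I. z i - w i)"
proof -
  have "\<bar>u i - w i\<bar> \<le> vnorm I (\<lambda>i\<in>I. u i - z i) + vnorm I (\<lambda>i\<in>I. z i - w i)" if "i \<in> I" for i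
    using abs_le_vnorm[OF assms that, of "\<lambda>i\<in>I. u i - z i"]
      abs_le_vnorm[OF assms that, of "\<lambda>i\<in>I. z i - w i"] that by simp
  then show ?thesis
    by (subst vnorm_le_iff) (auto simp: assms vnorm_nonneg)
qed

text \<open>\<open>mnorm\<close> is a supremum of reals, so it dominates its members only once they
  are known to be bounded above; the sum of all absolute entries is a crude bound.\<close>

lemma abs_mat_vec_le_mnorm:
  assumes "finite I" "u \<in> gvecs I" "vnorm I u \<le> 1" "i \<in> I"
  shows "\<bar>mat_vec I B u i\<bar> \<le> mnorm I B"
proof -
  let ?S = "{u \<in> gvecs I. vnorm I u \<le> 1}"
  let ?R = "\<Sum>i\<in>I. \<Sum>j\<in>I. \<bar>B i j\<bar>"
  have "vnorm I (mat_vec I B w) \<le> ?R" if w: "w \<in> ?S" for w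
  proof -
    have "\<bar>mat_vec I B w k\<bar> \<le> ?R" if k: "k \<in> I" for k
    proof -
      have "\<bar>mat_vec I B w k\<bar> \<le> (\<Sum>j\<in>I. \<bar>B k j * w j\<bar>)"
        using k by (simp add: mat_vec_def sum_abs)
      also have "\<dots> \<le> (\<Sum>j\<in>I. \<bar>B k j\<bar>)"
      proof (rule sum_mono)
        fix j assume "j \<in> I"
        then have "\<bar>w j\<bar> \<le> 1"
          using abs_le_vnorm[OF assms(1), of j w] w by auto
        then show "\<bar>B k j * w j\<bar> \<le> \<bar>B k j\<bar>"
          by (simp add: abs_mult mult_left_le)
      qed
      also have "\<dots> \<le> ?R"
        by (rule member_le_sum[OF k]) (auto simp: assms sum_nonneg)
      finally show ?thesis .
    qed
    then show ?thesis
      by (subst vnorm_le_iff) (auto simp: assms sum_nonneg)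
  qed
  then have "bdd_above ((\<lambda>u. vnorm I (mat_vec I B u)) ` ?S)"
    by (rule bdd_aboveI2)
  then have "vnorm I (mat_vec I B u) \<le> mnorm I B"
    unfolding mnorm_def by (rule cSUP_upper[rotated]) (use assms in auto)
  then show ?thesis
    using abs_le_vnorm[OF assms(1,4), of "mat_vec I B u"] by linarith
qed

text \<open>Testing with a unit vector isolates one entry. This turns the norm bound of (A1)(ii)
  into the entrywise bound that makes the damped map monotone.\<close>

lemma abs_entry_le_mnorm:
  assumes "finite I" "i \<in> I" "j \<in> I"
  shows "\<bar>B i j\<bar> \<le> mnorm I B"
proof -
  let ?e = "\<lambda>k\<in>I. if k = j then 1 else (0::real)"
  have "vnorm I ?e \<le> 1"
    by (subst vnorm_le_iff) (auto simp: assms)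
  moreover have "mat_vec I B ?e i = B i j"
    using assms by (simp add: mat_vec_def if_distrib[of "\<lambda>x. _ * x"] cong: if_cong)
  ultimately show ?thesis
    using abs_mat_vec_le_mnorm[OF assms(1) _ _ assms(2), of ?e B] by auto
qed

text \<open>Testing with the all-ones vector turns (A1)(iii) into a bound on the row sums of the
  inverse, the form in which a nonnegative inverse is applied to constant upper bounds.\<close>

lemma row_sum_le_mnorm:
  assumes "finite I" "i \<in> I"
  shows "(\<Sum>j\<in>I. B i j) \<le> mnorm I B"
proof -
  let ?e = "\<lambda>k\<in>I. (1::real)"
  have "vnorm I ?e \<le> 1"
    by (subst vnorm_le_iff) (auto simp: assms)
  moreover have "mat_vec I B ?e i = (\<Sum>j\<in>I. B i j)"
    using assms by (simp add: mat_vec_def)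
  ultimately show ?thesis
    using abs_mat_vec_le_mnorm[OF assms(1) _ _ assms(2), of ?e B] by auto
qed

lemma is_inverse_sum_left:
  assumes "finite I" "is_inverse I B D" "i \<in> I"
  shows "(\<Sum>k\<in>I. D i k * (\<Sum>j\<in>I. B k j * w j)) = w i"
proof -
  have "(\<Sum>k\<in>I. D i k * (\<Sum>j\<in>I. B k j * w j)) = (\<Sum>k\<in>I. \<Sum>j\<in>I. D i k * B k j * w j)"
    by (simp add: sum_distrib_left mult.assoc)
  also have "\<dots> = (\<Sum>j\<in>I. (\<Sum>k\<in>I. D i k * B k j) * w j)"
    by (subst sum.swap) (simp add: sum_distrib_right)
  also have "\<dots> = (\<Sum>j\<in>I. (if i = j then 1 else 0) * w j)"
    using assms by (intro sum.cong) (auto simp: is_inverse_def)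
  also have "\<dots> = w i"
    using assms by (simp add: if_distrib[of "\<lambda>x. x * _"] cong: if_cong)
  finally show ?thesis .
qed

lemma is_inverse_sum_right:
  assumes "finite I" "is_inverse I B D" "i \<in> I"
  shows "(\<Sum>k\<in>I. B i k * (\<Sum>j\<in>I. D k j * w j)) = w i"
  using is_inverse_sum_left[of I D B i w] assms by (auto simp: is_inverse_def)


section \<open>The nonlinear system of one time step\<close>

text \<open>One time step with the time index frozen. \<open>C\<close> may depend on the step and
  the grid, and serves finiteness of suprema and existence; \<open>K\<close> enters the stability
  estimate. The inverses are those of matrices with a separate control in each row, since the
  comparison argument chooses controls row by row.\<close>

locale policy_system =
  fixes I :: "int set" and A :: "'a set" and m :: "'a \<Rightarrow> gmat" and C K :: real
  assumes fin: "finite I" and ne: "A \<noteq> {}" and C_pos: "0 < C"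
    and entry_bound: "\<And>a i j. \<lbrakk>a \<in> A; i \<in> I; j \<in> I\<rbrakk> \<Longrightarrow> \<bar>m a i j\<bar> \<le> C"
    and offdiag: "\<And>a i j. \<lbrakk>a \<in> A; i \<in> I; j \<in> I; i \<noteq> j\<rbrakk> \<Longrightarrow> m a i j \<le> 0"
    and inverse: "\<And>a. a \<in> I \<rightarrow>\<^sub>E A \<Longrightarrow>
      \<exists>D. is_inverse I (\<lambda>i j. m (a i) i j) D \<and> (\<forall>i\<in>I. \<forall>j\<in>I. 0 \<le> D i j) \<and> (\<forall>i\<in>I. (\<Sum>j\<in>I. D i j) \<le> K)"
begin

definition row :: "'a \<Rightarrow> gvec \<Rightarrow> gvec" where
  "row a w i = (\<Sum>j\<in>I. m a i j * w j)"

text \<open>The supremum runs over single controls instead of policies: component \<open>i\<close>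
  of a policy system sees only the control chosen in row \<open>i\<close>.\<close>

definition res :: "('a \<Rightarrow> gvec) \<Rightarrow> gvec \<Rightarrow> gvec" where
  "res g w i = (SUP a\<in>A. row a w i - g a i)"

text \<open>Asking for a nonnegative \<open>R\<close> lets it serve directly as the gap
  \<open>d\<close> in \<open>comparison\<close>, even for empty \<open>I\<close>.\<close>

definition rhs_bounded :: "('a \<Rightarrow> gvec) \<Rightarrow> bool" where
  "rhs_bounded g \<longleftrightarrow> (\<exists>R\<ge>0. \<forall>a\<in>A. \<forall>i\<in>I. \<bar>g a i\<bar> \<le> R)"

lemma rhs_boundedI:
  assumes "\<And>a i. \<lbrakk>a \<in> A; i \<in> I\<rbrakk> \<Longrightarrow> \<bar>g a i\<bar> \<le> R"
  shows "rhs_bounded g"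
  unfolding rhs_bounded_def by (rule exI[of _ "\<bar>R\<bar>"]) (use assms in force)

lemma res_bdd:
  assumes "rhs_bounded g" "i \<in> I"
  shows "bdd_above ((\<lambda>a. row a w i - g a i) ` A)"
proof -
  obtain R where R: "\<And>a. a \<in> A \<Longrightarrow> \<bar>g a i\<bar> \<le> R"
    using assms by (auto simp: rhs_bounded_def)
  show ?thesis
  proof (rule bdd_aboveI2)
    fix a assume a: "a \<in> A"
    have "row a w i \<le> (\<Sum>j\<in>I. C * \<bar>w j\<bar>)"
      unfolding row_def
    proof (rule sum_mono)
      fix j assume "j \<in> I"
      then have "\<bar>m a i j\<bar> * \<bar>w j\<bar> \<le> C * \<bar>w j\<bar>"
        using entry_bound[OF a assms(2)] by (intro mult_right_mono) auto
      then show "m a i j * w j \<le> C * \<bar>w j\<bar>"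
        by (metis abs_ge_self abs_mult order_trans)
    qed
    then show "row a w i - g a i \<le> (\<Sum>j\<in>I. C * \<bar>w j\<bar>) + R"
      using R[OF a] by linarith
  qed
qed

lemma row_le_res:
  assumes "rhs_bounded g" "i \<in> I" "a \<in> A"
  shows "row a w i - g a i \<le> res g w i"
  unfolding res_def by (rule cSUP_upper[OF assms(3) res_bdd[OF assms(1,2)]])

lemma res_le:
  assumes "\<And>a. a \<in> A \<Longrightarrow> row a w i - g a i \<le> c"
  shows "res g w i \<le> c"
  unfolding res_def by (rule cSUP_least[OF ne]) (use assms in auto)

text \<open>Two data \<open>g\<close>, \<open>g'\<close> with a one-sided gap \<open>d\<close> are
  allowed so that one statement gives the lower bound for supersolutions, uniqueness
  (\<open>d\<close> = 0) and Lipschitz dependence on the data.\<close>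

lemma comparison:
  assumes g: "rhs_bounded g" and g': "rhs_bounded g'"
    and w: "\<And>i. i \<in> I \<Longrightarrow> res g w i \<le> 0" and z: "\<And>i. i \<in> I \<Longrightarrow> 0 \<le> res g' z i"
    and d: "0 \<le> d" "\<And>a i. \<lbrakk>a \<in> A; i \<in> I\<rbrakk> \<Longrightarrow> g a i \<le> g' a i + d"
    and i: "i \<in> I"
  shows "w i \<le> z i + K * d"
proof -
  \<comment> \<open>The supremum over controls may fail to be attained, so the controls are optimal
    only up to a slack \<eta>, which tends to 0 at the end.\<close>
  have approx: "w i - z i \<le> K * (d + \<eta>)" if "0 < \<eta>" for \<eta>
  proof -
    have "\<exists>a\<in>A. - \<eta> < row a z k - g' a k" if "k \<in> I" for k
    proof -
      have "- \<eta> < res g' z k"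
        using z[OF that] \<open>0 < \<eta>\<close> by linarith
      then show ?thesis
        unfolding res_def by (subst (asm) less_cSUP_iff[OF ne res_bdd[OF g' that]])
    qed
    then obtain p where p: "\<And>k. k \<in> I \<Longrightarrow> p k \<in> A" "\<And>k. k \<in> I \<Longrightarrow> - \<eta> < row (p k) z k - g' (p k) k"
      by metis
    define a where "a = restrict p I"
    have "a \<in> I \<rightarrow>\<^sub>E A"
      using p by (auto simp: a_def)
    from inverse[OF this] obtain D where D: "is_inverse I (\<lambda>i j. m (a i) i j) D"
      "\<And>i j. \<lbrakk>i \<in> I; j \<in> I\<rbrakk> \<Longrightarrow> 0 \<le> D i j" "\<And>i. i \<in> I \<Longrightarrow> (\<Sum>j\<in>I. D i j) \<le> K"
      by auto
    \<comment> \<open>The same policy is used for both vectors: for \<open>w\<close> every control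
      gives at most \<open>res g w\<close> <= 0, while for \<open>z\<close> this one stays above
      -\<eta>. The difference is linear in \<open>w - z\<close>.\<close>
    have *: "row (a k) (\<lambda>j. w j - z j) k \<le> d + \<eta>" if k: "k \<in> I" for k
    proof -
      have "row (a k) w k - g (a k) k \<le> 0"
        using row_le_res[OF g k, of "a k" w] w[OF k] p k by (auto simp: a_def)
      moreover have "- \<eta> < row (a k) z k - g' (a k) k"
        using p k by (simp add: a_def)
      moreover have "g (a k) k \<le> g' (a k) k + d"
        using d p k by (simp add: a_def)
      moreover have "row (a k) (\<lambda>j. w j - z j) k = row (a k) w k - row (a k) z k"
        by (simp add: row_def right_diff_distrib sum_subtractf)
      ultimately show ?thesis by linarith
    qed
    \<comment> \<open>Multiplication by \<open>D\<close> recovers \<open>w - z\<close>; nonnegative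
      entries preserve the inequality, and row sums at most \<open>K\<close> control the constant
      right-hand side.\<close>
    have "w i - z i = (\<Sum>k\<in>I. D i k * row (a k) (\<lambda>j. w j - z j) k)"
      unfolding row_def using is_inverse_sum_left[OF fin D(1) i, of "\<lambda>j. w j - z j"] by simp
    also have "\<dots> \<le> (\<Sum>k\<in>I. D i k * (d + \<eta>))"
      by (intro sum_mono mult_left_mono * D i)
    also have "\<dots> \<le> K * (d + \<eta>)"
      unfolding sum_distrib_right[symmetric]
      using D(3)[OF i] d(1) \<open>0 < \<eta>\<close> by (intro mult_right_mono) auto
    finally show ?thesis .
  qed
  have "((\<lambda>\<eta>. K * (d + \<eta>)) \<longlongrightarrow> K * (d + 0)) (at_right 0)"
    by (intro tendsto_intros)
  then have "w i - z i \<le> K * (d + 0)"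
    by (rule tendsto_lowerbound)
      (auto intro: approx eventually_mono[OF eventually_at_right_less[of "0::real"]])
  then show ?thesis by simp
qed

lemma res_diff_le:
  assumes g: "rhs_bounded g" and le: "\<And>j. j \<in> I \<Longrightarrow> w j \<le> z j" and i: "i \<in> I"
  shows "res g z i - res g w i \<le> C * (z i - w i)"
proof -
  have "row a z i - g a i \<le> res g w i + C * (z i - w i)" if a: "a \<in> A" for a
  proof -
    have "row a z i - row a w i = (\<Sum>j\<in>I. m a i j * (z j - w j))"
      by (simp add: row_def right_diff_distrib sum_subtractf)
    also have "\<dots> \<le> (\<Sum>j\<in>I. if j = i then C * (z i - w i) else 0)"
    proof (rule sum_mono)
      fix j assume j: "j \<in> I"
      show "m a i j * (z j - w j) \<le> (if j = i then C * (z i - w i) else 0)"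
        using offdiag[OF a i j] entry_bound[OF a i i] le[OF j]
        by (auto intro: mult_right_mono mult_nonpos_nonneg)
    qed
    also have "\<dots> = C * (z i - w i)"
      using i fin by simp
    finally show ?thesis
      using row_le_res[OF g i a, of w] by linarith
  qed
  then have "res g z i \<le> res g w i + C * (z i - w i)"
    by (rule res_le)
  then show ?thesis by linarith
qed

text \<open>Freeze one control everywhere and solve its linear system: that control contributes 0 to
  the supremum, which is therefore nonnegative.\<close>

lemma ex_supersolution: "\<exists>z\<in>gvecs I. \<forall>i\<in>I. 0 \<le> res g z i" if g: "rhs_bounded g"
proof -
  obtain \<alpha> where \<alpha>: "\<alpha> \<in> A" using ne by auto
  then have "(\<lambda>i\<in>I. \<alpha>) \<in> I \<rightarrow>\<^sub>E A" by auto
  from inverse[OF this] obtain D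
    where D: "is_inverse I (\<lambda>i j. m ((\<lambda>i\<in>I. \<alpha>) i) i j) D" by auto
  define z where "z = (\<lambda>i\<in>I. \<Sum>j\<in>I. D i j * g \<alpha> j)"
  have "row \<alpha> z i = g \<alpha> i" if "i \<in> I" for i
    using is_inverse_sum_right[OF fin D that, of "g \<alpha>"] that by (simp add: row_def z_def)
  then have "0 \<le> res g z i" if "i \<in> I" for i
    using row_le_res[OF g that \<alpha>, of z] that by simp
  moreover have "z \<in> gvecs I" by (simp add: z_def)
  ultimately show ?thesis by blast
qed

lemma ex1_solution:
  assumes g: "rhs_bounded g"
  shows "\<exists>!w. w \<in> gvecs I \<and> (\<forall>i\<in>I. res g w i = 0)"
proof -
  define S where "S = {z \<in> gvecs I. \<forall>i\<in>I. 0 \<le> res g z i}"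
  define w where "w = (\<lambda>i\<in>I. INF z\<in>S. z i)"
  define damp where "damp z = (\<lambda>i\<in>I. z i - res g z i / C)" for z
  have S_ne: "S \<noteq> {}"
    using ex_supersolution[OF g] by (auto simp: S_def)
  obtain R where R: "0 \<le> R" "\<And>a i. \<lbrakk>a \<in> A; i \<in> I\<rbrakk> \<Longrightarrow> \<bar>g a i\<bar> \<le> R"
    using g by (auto simp: rhs_bounded_def)
  \<comment> \<open>The infimum \<open>w\<close> is meaningful only if \<open>S\<close> is bounded
    below. The zero vector is a subsolution for zero data, and zero data exceed \<open>g\<close> by
    at most \<open>R\<close>.\<close>
  have "- (K * R) \<le> z i" if "z \<in> S" "i \<in> I" for z i
  proof -
    have "0 \<le> z i + K * R"
    proof (rule comparison[where g = "\<lambda>_ _. 0" and g' = g and w = "\<lambda>_. 0"])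
      show "rhs_bounded (\<lambda>_ _. 0)" by (rule rhs_boundedI[where R = 0]) simp
      show "res (\<lambda>_ _. 0) (\<lambda>_. 0) i \<le> 0" for i
        by (rule res_le) (simp add: row_def)
      show "0 \<le> g a i + R" if "a \<in> A" "i \<in> I" for a i
        using R(2)[OF that] by linarith
    qed (use that g R in \<open>auto simp: S_def\<close>)
    then show ?thesis by linarith
  qed
  then have bdd: "bdd_below ((\<lambda>z. z i) ` S)" if "i \<in> I" for i
    using that by (intro bdd_belowI2)
  have w_le: "w i \<le> z i" if "z \<in> S" "i \<in> I" for z i
    using cINF_lower[OF bdd that(1)] that(2) by (simp add: w_def)
  have damp_mono: "damp y i \<le> damp z i" if "\<And>j. j \<in> I \<Longrightarrow> y j \<le> z j" "i \<in> I" for y z i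
  proof -
    have "res g z i - res g y i \<le> C * (z i - y i)"
      by (rule res_diff_le[OF g]) (use that in auto)
    then have "(res g z i - res g y i) / C \<le> z i - y i"
      using C_pos by (simp add: pos_divide_le_eq mult.commute)
    then show ?thesis
      using that(2) by (simp add: damp_def diff_divide_distrib)
  qed
  \<comment> \<open>Supersolutions are exactly the vectors that \<open>damp\<close> does not
    increase, so \<open>S\<close> is the set of post-fixed points whose infimum is taken.\<close>
  have damp_le: "damp z i \<le> z i \<longleftrightarrow> 0 \<le> res g z i" if "i \<in> I" for z i
    using C_pos that by (simp add: damp_def zero_le_divide_iff)
  have damp_w: "damp w i \<le> w i" if i: "i \<in> I" for i
  proof -
    have "damp w i \<le> z i" if "z \<in> S" for z
    proof -
      have "damp w i \<le> damp z i"
        by (rule damp_mono) (use w_le that i in auto)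
      also have "\<dots> \<le> z i"
        using damp_le[OF i, of z] that i by (simp add: S_def)
      finally show ?thesis .
    qed
    then show ?thesis
      using i by (simp add: w_def cINF_greatest[OF S_ne])
  qed
  \<comment> \<open>Monotonicity makes \<open>damp w\<close> a supersolution again, and minimality
    of \<open>w\<close> then gives the reverse inequality \<open>w\<close> <=
    \<open>damp w\<close>.\<close>
  then have "damp (damp w) i \<le> damp w i" if "i \<in> I" for i
    by (rule damp_mono[OF _ that])
  then have "damp w \<in> S"
    using damp_le by (auto simp: S_def damp_def)
  then have "w i \<le> damp w i" if "i \<in> I" for i
    by (rule w_le[OF _ that])
  with damp_w have "damp w i = w i" if "i \<in> I" for i
    using that by (simp add: order_antisym)
  then have res_w: "res g w i = 0" if "i \<in> I" for i
    using that C_pos by (auto simp: damp_def)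
  show ?thesis
  proof (rule ex1I)
    show "w \<in> gvecs I \<and> (\<forall>i\<in>I. res g w i = 0)"
      using res_w by (auto simp: w_def)
  next
    fix y assume y: "y \<in> gvecs I \<and> (\<forall>i\<in>I. res g y i = 0)"
    show "y = w"
    proof (rule extensionalityI[of _ I])
      fix i assume i: "i \<in> I"
      have "y i \<le> w i + K * 0"
        by (rule comparison[OF g g]) (use y res_w i in auto)
      moreover have "w i \<le> y i + K * 0"
        by (rule comparison[OF g g]) (use y res_w i in auto)
      ultimately show "y i = w i" by simp
    qed (use y in \<open>auto simp: w_def PiE_def\<close>)
  qed
qed

end

section \<open>The scheme map \<open>S_M\<close> and its Lipschitz constant under (A1)\<close>

lemma SUP_policies:
  assumes "i \<in> I"
  shows "(SUP a\<in>I \<rightarrow>\<^sub>E A. f (a i)) = (SUP x\<in>A. f x)"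
proof -
  \<comment> \<open>Each control is the value at \<open>i\<close> of a constant policy.\<close>
  have "(\<lambda>a. f (a i)) ` (I \<rightarrow>\<^sub>E A) = f ` A"
  proof (intro equalityI subsetI)
    fix y assume "y \<in> f ` A"
    then obtain x where "x \<in> A" "y = f x" by auto
    then show "y \<in> (\<lambda>a. f (a i)) ` (I \<rightarrow>\<^sub>E A)"
      using assms by (intro image_eqI[of _ _ "\<lambda>j\<in>I. x"]) auto
  qed (use assms in auto)
  then show ?thesis by simp
qed

text \<open>Unique solvability gives the definite description in \<open>S_M\<close> its meaning. The
  matrices belong to the new time level \<open>n + 1\<close>, the data to the old level
  \<open>n\<close>.\<close>

lemma (in policy_system) S_M_solves:
  assumes "m = (\<lambda>a. M a (n + 1))" and "rhs_bounded (\<lambda>a. G a n \<phi>)"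
  shows "S_M I A M G n \<phi> \<in> gvecs I"
    and "i \<in> I \<Longrightarrow> res (\<lambda>a. G a n \<phi>) (S_M I A M G n \<phi>) i = 0"
proof -
  have "(SUP a \<in> I \<rightarrow>\<^sub>E A. mat_vec I (policy_mat M a (n + 1)) w i - policy_map I G a n \<phi> i)
      = res (\<lambda>a. G a n \<phi>) w i" if "i \<in> I" for w i
    using SUP_policies[OF that, of "\<lambda>x. row x w i - G x n \<phi> i" A] that
    unfolding res_def row_def
    by (simp add: mat_vec_def policy_mat_def policy_map_def assms(1))
  then have "S_M I A M G n \<phi> = (THE w. w \<in> gvecs I \<and> (\<forall>i\<in>I. res (\<lambda>a. G a n \<phi>) w i = 0))"
    by (simp add: S_M_def)
  with theI'[OF ex1_solution[OF assms(2)]]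
  have "S_M I A M G n \<phi> \<in> gvecs I \<and> (\<forall>i\<in>I. res (\<lambda>a. G a n \<phi>) (S_M I A M G n \<phi>) i = 0)"
    by simp
  then show "S_M I A M G n \<phi> \<in> gvecs I"
    and "i \<in> I \<Longrightarrow> res (\<lambda>a. G a n \<phi>) (S_M I A M G n \<phi>) i = 0"
    by auto
qed

lemma (in policy_system) S_M_lipschitz:
  assumes m: "m = (\<lambda>a. M a (n + 1))" and "0 \<le> K" "0 \<le> d"
    and \<phi>: "rhs_bounded (\<lambda>a. G a n \<phi>)" and \<psi>: "rhs_bounded (\<lambda>a. G a n \<psi>)"
    and d: "\<And>a i. \<lbrakk>a \<in> A; i \<in> I\<rbrakk> \<Longrightarrow> \<bar>G a n \<phi> i - G a n \<psi> i\<bar> \<le> d"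
  shows "vnorm I (\<lambda>i\<in>I. S_M I A M G n \<phi> i - S_M I A M G n \<psi> i) \<le> K * d"
proof (subst vnorm_le_iff)
  show "\<forall>i\<in>I. \<bar>(\<lambda>i\<in>I. S_M I A M G n \<phi> i - S_M I A M G n \<psi> i) i\<bar> \<le> K * d"
  proof
    fix i assume i: "i \<in> I"
    have "S_M I A M G n \<phi> i \<le> S_M I A M G n \<psi> i + K * d"
    proof (rule comparison[OF \<phi> \<psi> _ _ \<open>0 \<le> d\<close> _ i])
      show "G a n \<phi> i \<le> G a n \<psi> i + d" if "a \<in> A" "i \<in> I" for a i
        using d[OF that] by linarith
    qed (simp_all add: S_M_solves(2)[of M n G, OF m] \<phi> \<psi>)
    moreover have "S_M I A M G n \<psi> i \<le> S_M I A M G n \<phi> i + K * d"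
    proof (rule comparison[OF \<psi> \<phi> _ _ \<open>0 \<le> d\<close> _ i])
      show "G a n \<psi> i \<le> G a n \<phi> i + d" if "a \<in> A" "i \<in> I" for a i
        using d[OF that] by linarith
    qed (simp_all add: S_M_solves(2)[of M n G, OF m] \<phi> \<psi>)
    ultimately show "\<bar>(\<lambda>i\<in>I. S_M I A M G n \<phi> i - S_M I A M G n \<psi> i) i\<bar> \<le> K * d"
      using i by simp
  qed
qed (use fin assms in auto)

text \<open>The constant in (A1)(ii) carries no sign; \<open>max 1 C\<close> makes it positive, as
  needed for dividing the residual by it.\<close>

lemma policy_systemI:
  assumes fin: "finite I" and ne: "A \<noteq> {}"
    and Mm: "\<And>a. a \<in> I \<rightarrow>\<^sub>E A \<Longrightarrow> is_M_matrix I (policy_mat M a n)"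
    and bound: "\<And>a. a \<in> I \<rightarrow>\<^sub>E A \<Longrightarrow> mnorm I (policy_mat M a n) \<le> C"
    and inv: "\<And>a D. \<lbrakk>a \<in> I \<rightarrow>\<^sub>E A; is_inverse I (policy_mat M a n) D\<rbrakk> \<Longrightarrow> mnorm I D \<le> K"
  shows "policy_system I A (\<lambda>a. M a n) (max 1 C) K"
proof
  fix a i j assume a: "a \<in> A" and i: "i \<in> I" and j: "j \<in> I"
  \<comment> \<open>A constant policy displays all rows of the matrix of \<open>a\<close>, so
    properties of policy matrices become properties of each single control.\<close>
  let ?a = "\<lambda>i\<in>I. a"
  have pa: "?a \<in> I \<rightarrow>\<^sub>E A" using a by auto
  have entry: "policy_mat M ?a n i j = M a n i j"
    using i by (simp add: policy_mat_def)
  show "\<bar>M a n i j\<bar> \<le> max 1 C"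
    using abs_entry_le_mnorm[OF fin i j, of "policy_mat M ?a n"] bound[OF pa] entry by simp
  show "M a n i j \<le> 0" if "i \<noteq> j"
    using Mm[OF pa] i j that entry by (metis is_M_matrix_def)
next
  fix a assume a: "a \<in> I \<rightarrow>\<^sub>E A"
  then obtain D where D: "is_inverse I (policy_mat M a n) D" "\<forall>i\<in>I. \<forall>j\<in>I. 0 \<le> D i j"
    using Mm[OF a] by (auto simp: is_M_matrix_def)
  moreover have "(\<Sum>j\<in>I. D i j) \<le> K" if "i \<in> I" for i
    using row_sum_le_mnorm[OF fin that, of D] inv[OF a D(1)] by linarith
  ultimately show "\<exists>D. is_inverse I (\<lambda>i j. M (a i) n i j) D \<and> (\<forall>i\<in>I. \<forall>j\<in>I. 0 \<le> D i j)
      \<and> (\<forall>i\<in>I. (\<Sum>j\<in>I. D i j) \<le> K)"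
    by (auto simp: policy_mat_def)
qed (use fin ne in auto)

text \<open>Constant policies again pass from policies to single controls, here for the maps of
  (A1)(v).\<close>

lemma policy_map_component_lipschitz:
  assumes fin: "finite I" and "0 \<le> L" and a: "a \<in> A" and i: "i \<in> I"
    and lip: "\<And>a. a \<in> I \<rightarrow>\<^sub>E A \<Longrightarrow>
      vnorm I (\<lambda>i\<in>I. policy_map I G a n \<phi> i - policy_map I G a n \<psi> i) \<le> L"
  shows "\<bar>G a n \<phi> i - G a n \<psi> i\<bar> \<le> L"
proof -
  have "(\<lambda>i\<in>I. a) \<in> I \<rightarrow>\<^sub>E A" using a by auto
  from lip[OF this] show ?thesis
    using i assms(2) fin by (simp add: vnorm_le_iff policy_map_def)
qed

lemma policy_map_component_bound:
  assumes fin: "finite I" and "0 \<le> L" and a: "a \<in> A" and i: "i \<in> I"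
    and bound: "\<And>a. a \<in> I \<rightarrow>\<^sub>E A \<Longrightarrow> vnorm I (policy_map I G a n \<phi>) \<le> L"
  shows "\<bar>G a n \<phi> i\<bar> \<le> L"
proof -
  have "(\<lambda>i\<in>I. a) \<in> I \<rightarrow>\<^sub>E A" using a by auto
  from bound[OF this] show ?thesis
    using i assms(2) fin by (simp add: vnorm_le_iff policy_map_def)
qed

text \<open>The Lipschitz constant is put in the form exp(C \<tau>) because these factors multiply
  over \<open>n\<close> steps to exp(C n \<tau>), which is at most exp(C T). \<open>C\<close> is
  chosen before the grid.\<close>

lemma assumption_A1_S_M:
  assumes A1: "assumption_A1 P I A M G" and ne: "A \<noteq> {}"
    and fin: "\<forall>(\<tau>, h)\<in>P. finite (I h)" and pos: "\<forall>(\<tau>, h)\<in>P. 0 < \<tau>"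
  obtains C where "0 \<le> C"
    and "\<And>\<tau> h n \<phi>. \<lbrakk>(\<tau>, h) \<in> P; \<phi> \<in> gvecs (I h)\<rbrakk> \<Longrightarrow> S_M (I h) A (M \<tau> h) (G \<tau> h) n \<phi> \<in> gvecs (I h)"
    and "\<And>\<tau> h n \<phi> \<psi>. \<lbrakk>(\<tau>, h) \<in> P; \<phi> \<in> gvecs (I h); \<psi> \<in> gvecs (I h)\<rbrakk> \<Longrightarrow>
      vnorm (I h) (\<lambda>i\<in>I h. S_M (I h) A (M \<tau> h) (G \<tau> h) n \<phi> i - S_M (I h) A (M \<tau> h) (G \<tau> h) n \<psi> i)
        \<le> exp (C * \<tau>) * vnorm (I h) (\<lambda>i\<in>I h. \<phi> i - \<psi> i)"
proof -
  note A1' = A1[unfolded assumption_A1_def]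
  have Mm: "is_M_matrix (I h) (policy_mat (M \<tau> h) a n)"
    if "(\<tau>, h) \<in> P" "a \<in> I h \<rightarrow>\<^sub>E A" "n \<ge> 1" for \<tau> h a n
    using bspec[OF conjunct1[OF A1'] that(1)] that(2,3) by simp
  have bound: "\<exists>C. \<forall>a \<in> I h \<rightarrow>\<^sub>E A. mnorm (I h) (policy_mat (M \<tau> h) a n) \<le> C"
    if "(\<tau>, h) \<in> P" "n \<ge> 1" for \<tau> h n
    using bspec[OF conjunct1[OF conjunct2[OF A1']] that(1)] that(2) by simp
  obtain C1 where C1: "C1 > 0" and inv': "\<forall>(\<tau>, h)\<in>P. \<forall>n\<ge>1. \<forall>a \<in> I h \<rightarrow>\<^sub>E A. \<forall>D.
      is_inverse (I h) (policy_mat (M \<tau> h) a n) D \<longrightarrow> mnorm (I h) D \<le> 1 + C1 * \<tau>"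
    using A1' by (elim conjE exE)
  have inv: "mnorm (I h) D \<le> 1 + C1 * \<tau>"
    if "(\<tau>, h) \<in> P" "n \<ge> 1" "a \<in> I h \<rightarrow>\<^sub>E A" "is_inverse (I h) (policy_mat (M \<tau> h) a n) D"
    for \<tau> h n a D
    using bspec[OF inv' that(1)] that(2-) by simp
  obtain C2 where C2: "C2 > 0" and G: "\<forall>(\<tau>, h)\<in>P. \<forall>a \<in> I h \<rightarrow>\<^sub>E A. \<forall>n.
        (\<forall>\<phi>\<in>gvecs (I h). \<forall>\<psi>\<in>gvecs (I h).
           vnorm (I h) (\<lambda>i\<in>I h. policy_map (I h) (G \<tau> h) a n \<phi> i
                                - policy_map (I h) (G \<tau> h) a n \<psi> i)
             \<le> (1 + C2 * \<tau>) * vnorm (I h) (\<lambda>i\<in>I h. \<phi> i - \<psi> i)) \<and>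
        vnorm (I h) (policy_map (I h) (G \<tau> h) a n (\<lambda>i\<in>I h. 0)) \<le> C2 * \<tau>"
    using A1' by (elim conjE exE)
  have step: "S_M (I h) A (M \<tau> h) (G \<tau> h) n \<phi> \<in> gvecs (I h) \<and>
      vnorm (I h) (\<lambda>i\<in>I h. S_M (I h) A (M \<tau> h) (G \<tau> h) n \<phi> i - S_M (I h) A (M \<tau> h) (G \<tau> h) n \<psi> i)
        \<le> exp ((C1 + C2) * \<tau>) * vnorm (I h) (\<lambda>i\<in>I h. \<phi> i - \<psi> i)"
    if P: "(\<tau>, h) \<in> P" and \<phi>: "\<phi> \<in> gvecs (I h)" and \<psi>: "\<psi> \<in> gvecs (I h)" for \<tau> h n \<phi> \<psi>
  proof -
    let ?J = "I h" and ?S = "S_M (I h) A (M \<tau> h) (G \<tau> h) n"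
    have finI: "finite ?J" and \<tau>: "0 < \<tau>" using fin pos P by auto
    have nn: "0 \<le> (1 + C2 * \<tau>) * vnorm ?J (\<lambda>i\<in>?J. \<phi> i - \<psi> i)" for \<phi> \<psi>
      using C2 \<tau> vnorm_nonneg[OF finI] by simp
    obtain C where C: "\<forall>a \<in> ?J \<rightarrow>\<^sub>E A. mnorm ?J (policy_mat (M \<tau> h) a (n + 1)) \<le> C"
      using bound[OF P, of "n + 1"] by auto
    \<comment> \<open>The index \<open>n + 1\<close> is at least 1, so the matrix hypotheses apply
      to the first step \<open>n\<close> = 0 as well.\<close>
    interpret policy_system ?J A "\<lambda>a. M \<tau> h a (n + 1)" "max 1 C" "1 + C1 * \<tau>"
      by (rule policy_systemI[OF finI ne]) (use Mm[OF P, of _ "n + 1"] C inv[OF P, of "n + 1"] in auto)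
    have G_lip: "\<bar>G \<tau> h a n \<phi> i - G \<tau> h a n \<psi> i\<bar> \<le> (1 + C2 * \<tau>) * vnorm ?J (\<lambda>i\<in>?J. \<phi> i - \<psi> i)"
      if "a \<in> A" "i \<in> ?J" "\<phi> \<in> gvecs ?J" "\<psi> \<in> gvecs ?J" for a i \<phi> \<psi>
      by (rule policy_map_component_lipschitz[where G = "G \<tau> h", OF finI nn that(1,2)])
        (use bspec[OF G P] that in auto)
    have G_0: "\<bar>G \<tau> h a n (\<lambda>i\<in>?J. 0) i\<bar> \<le> C2 * \<tau>" if "a \<in> A" "i \<in> ?J" for a i
      by (rule policy_map_component_bound[where G = "G \<tau> h" and n = n, OF finI _ that])
        (use bspec[OF G P] C2 \<tau> in auto)
    \<comment> \<open>Boundedness uniform in the control comes from the Lipschitz estimate against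
      the zero vector together with the bound at zero.\<close>
    have G_bdd: "rhs_bounded (\<lambda>a. G \<tau> h a n \<phi>)" if "\<phi> \<in> gvecs ?J" for \<phi>
    proof (rule rhs_boundedI)
      fix a i assume "a \<in> A" "i \<in> ?J"
      then show "\<bar>G \<tau> h a n \<phi> i\<bar>
          \<le> (1 + C2 * \<tau>) * vnorm ?J (\<lambda>i\<in>?J. \<phi> i - (\<lambda>i\<in>?J. 0) i) + C2 * \<tau>"
        using G_lip[of a i \<phi> "\<lambda>i\<in>?J. 0"] G_0[of a i] that by force
    qed
    have "vnorm ?J (\<lambda>i\<in>?J. ?S \<phi> i - ?S \<psi> i)
        \<le> (1 + C1 * \<tau>) * ((1 + C2 * \<tau>) * vnorm ?J (\<lambda>i\<in>?J. \<phi> i - \<psi> i))"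
      by (rule S_M_lipschitz[where M = "M \<tau> h" and G = "G \<tau> h" and n = n, OF refl _ nn G_bdd[OF \<phi>] G_bdd[OF \<psi>]])
        (use C1 \<tau> G_lip \<phi> \<psi> in auto)
    also have "\<dots> = ((1 + C1 * \<tau>) * (1 + C2 * \<tau>)) * vnorm ?J (\<lambda>i\<in>?J. \<phi> i - \<psi> i)"
      by simp
    also have "\<dots> \<le> exp ((C1 + C2) * \<tau>) * vnorm ?J (\<lambda>i\<in>?J. \<phi> i - \<psi> i)"
    proof (rule mult_right_mono[OF _ vnorm_nonneg[OF finI]])
      have "(1 + C1 * \<tau>) * (1 + C2 * \<tau>) \<le> exp (C1 * \<tau>) * exp (C2 * \<tau>)"
        using C1 C2 \<tau> by (intro mult_mono exp_ge_add_one_self) auto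
      then show "(1 + C1 * \<tau>) * (1 + C2 * \<tau>) \<le> exp ((C1 + C2) * \<tau>)"
        by (simp add: exp_add distrib_right)
    qed
    finally show ?thesis
      using S_M_solves(1)[where M = "M \<tau> h" and G = "G \<tau> h" and n = n, OF refl G_bdd[OF \<phi>]]
      by blast
  qed
  show thesis
    by (rule that[of "C1 + C2"]) (use C1 C2 step in auto)
qed


section \<open>Error of the filtered scheme\<close>

text \<open>\<open>filter_fun\<close> takes values in [-1, 1], so the correction is at most
  \<epsilon> \<tau> whatever the high order vector is.\<close>

lemma filter_combine_dist:
  assumes "finite I" "0 < \<epsilon>" "0 < \<tau>"
  shows "vnorm I (\<lambda>i\<in>I. filter_combine I \<epsilon> \<tau> wM wH i - wM i) \<le> \<epsilon> * \<tau>"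
  by (subst vnorm_le_iff)
    (use assms in \<open>auto simp: filter_combine_def filter_fun_def abs_mult divide_simps split: if_splits\<close>)

text \<open>The starting step and the two-step recursion differ only in the high order vector.
  Hiding it behind an existential gives a one-step recursion suited to ordinary induction.\<close>

lemma filtered_sol_Suc:
  "\<exists>wH. filtered_sol I A M G SH SH0 \<epsilon> \<tau> u0 (Suc n)
     = filter_combine I \<epsilon> \<tau> (S_M I A M G n (filtered_sol I A M G SH SH0 \<epsilon> \<tau> u0 n)) wH"
  by (cases n) auto

text \<open>Discrete Gronwall: \<open>n\<close> perturbations of size \<epsilon> \<tau>, each
  amplified by at most exp(C n \<tau>).\<close>

lemma filtered_sol_error:
  fixes A :: "'a set"
  assumes fin: "finite I" and \<epsilon>: "0 < \<epsilon>" and \<tau>: "0 < \<tau>" and C: "0 \<le> C" and u0: "u0 \<in> gvecs I"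
    and closed: "\<And>n \<phi>. \<phi> \<in> gvecs I \<Longrightarrow> S_M I A M G n \<phi> \<in> gvecs I"
    and lip: "\<And>n \<phi> \<psi>. \<lbrakk>\<phi> \<in> gvecs I; \<psi> \<in> gvecs I\<rbrakk> \<Longrightarrow>
      vnorm I (\<lambda>i\<in>I. S_M I A M G n \<phi> i - S_M I A M G n \<psi> i) \<le> exp (C * \<tau>) * vnorm I (\<lambda>i\<in>I. \<phi> i - \<psi> i)"
  shows "vnorm I (\<lambda>i\<in>I. filtered_sol I A M G SH SH0 \<epsilon> \<tau> u0 n i - monotone_sol I A M G u0 n i)
    \<le> real n * \<tau> * exp (C * (real n * \<tau>)) * \<epsilon>"
proof (induction n)
  case 0
  then show ?case using fin by (simp add: vnorm_le_iff)
next
  case (Suc n)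
  let ?u = "filtered_sol I A M G SH SH0 \<epsilon> \<tau> u0" and ?w = "monotone_sol I A M G u0"
  let ?S = "S_M I A M G n"
  obtain wH where wH: "?u (Suc n) = filter_combine I \<epsilon> \<tau> (?S (?u n)) wH"
    using filtered_sol_Suc by blast
  have u: "?u n \<in> gvecs I"
    using u0 filtered_sol_Suc[of I A M G SH SH0 \<epsilon> \<tau> u0 "n - 1"]
    by (cases n) (auto simp: filter_combine_def simp del: filtered_sol.simps(2,3))
  have w: "?w n \<in> gvecs I"
    by (induction n) (auto simp: u0 closed)
  \<comment> \<open>The intermediate vector is one monotone step from the filtered value: the first
    term is the filter correction, the second the propagated old error.\<close>
  have "vnorm I (\<lambda>i\<in>I. ?u (Suc n) i - ?w (Suc n) i)
      \<le> vnorm I (\<lambda>i\<in>I. ?u (Suc n) i - ?S (?u n) i) + vnorm I (\<lambda>i\<in>I. ?S (?u n) i - ?S (?w n) i)"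
    using vnorm_triangle_diff[OF fin, of "?u (Suc n)" "?S (?w n)" "?S (?u n)"] by simp
  also have "\<dots> \<le> \<epsilon> * \<tau> + exp (C * \<tau>) * vnorm I (\<lambda>i\<in>I. ?u n i - ?w n i)"
    unfolding wH by (intro add_mono filter_combine_dist lip fin \<epsilon> \<tau> u w)
  also have "\<dots> \<le> \<epsilon> * \<tau> + exp (C * \<tau>) * (real n * \<tau> * exp (C * (real n * \<tau>)) * \<epsilon>)"
    by (intro add_left_mono mult_left_mono Suc.IH) auto
  \<comment> \<open>The explicit factor 1 is enlarged next to the exponential, so that both terms
    share the same factor.\<close>
  also have "\<dots> = \<epsilon> * \<tau> * 1 + real n * \<tau> * exp (C * (real (Suc n) * \<tau>)) * \<epsilon>"
    by (simp add: algebra_simps flip: exp_add)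
  also have "\<dots> \<le> \<epsilon> * \<tau> * exp (C * (real (Suc n) * \<tau>)) + real n * \<tau> * exp (C * (real (Suc n) * \<tau>)) * \<epsilon>"
    using \<epsilon> \<tau> C by (intro add_right_mono mult_left_mono) auto
  also have "\<dots> = real (Suc n) * \<tau> * exp (C * (real (Suc n) * \<tau>)) * \<epsilon>"
    by (simp add: algebra_simps)
  finally show ?case .
qed

section \<open>The maximal error over the time levels, and the main result\<close>

lemma max_error_le_iff:
  "max_error T \<tau> I u w \<le> c \<longleftrightarrow> (\<forall>n\<le>nsteps T \<tau>. vnorm I (\<lambda>i\<in>I. u n i - w n i) \<le> c)"
  unfolding max_error_def by (subst Max_le_iff) auto

lemma vnorm_le_max_error:
  "n \<le> nsteps T \<tau> \<Longrightarrow> vnorm I (\<lambda>i\<in>I. u n i - w n i) \<le> max_error T \<tau> I u w"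
  using max_error_le_iff[of T \<tau> I u w "max_error T \<tau> I u w"] by simp

lemma max_error_nonneg:
  assumes "finite I"
  shows "0 \<le> max_error T \<tau> I u w"
  by (rule order_trans[OF vnorm_nonneg[OF assms] vnorm_le_max_error]) (rule le0)

lemma max_error_triangle:
  assumes "finite I"
  shows "max_error T \<tau> I u w \<le> max_error T \<tau> I u z + max_error T \<tau> I z w"
  unfolding max_error_le_iff
proof (intro allI impI)
  fix n assume n: "n \<le> nsteps T \<tau>"
  show "vnorm I (\<lambda>i\<in>I. u n i - w n i) \<le> max_error T \<tau> I u z + max_error T \<tau> I z w"
    by (rule order_trans[OF vnorm_triangle_diff[OF assms, where z = "z n"] add_mono])
      (intro vnorm_le_max_error n)+
qed

lemma nsteps_mult_le:
  assumes "0 < T" "0 < \<tau>" "n \<le> nsteps T \<tau>"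
  shows "real n * \<tau> \<le> T"
proof -
  have "real n \<le> real (nsteps T \<tau>)"
    using assms(3) by simp
  also have "\<dots> \<le> T / \<tau>"
    using assms by (simp add: nsteps_def)
  finally show ?thesis
    using assms by (simp add: field_simps)
qed

theorem theorem3p2:
  fixes T :: real
    and A :: "(real ^ 'm) set"
    and \<sigma> b f l :: "real \<Rightarrow> real \<Rightarrow> real ^ 'm \<Rightarrow> real"
    and v0 :: "real \<Rightarrow> real"
    and P :: "(real \<times> real) set"
    and I :: "real \<Rightarrow> int set"
    and M :: "real \<Rightarrow> real \<Rightarrow> real ^ 'm \<Rightarrow> nat \<Rightarrow> gmat"
    and G :: "real \<Rightarrow> real \<Rightarrow> real ^ 'm \<Rightarrow> nat \<Rightarrow> gvec \<Rightarrow> gvec"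
    and SH :: "real \<Rightarrow> real \<Rightarrow> nat \<Rightarrow> gvec \<Rightarrow> gvec \<Rightarrow> gvec"
    and SH0 :: "real \<Rightarrow> real \<Rightarrow> gvec \<Rightarrow> gvec"
    and \<epsilon> :: "real \<Rightarrow> real \<Rightarrow> real"
    and uM u :: "real \<Rightarrow> real \<Rightarrow> nat \<Rightarrow> gvec"
  assumes "T > 0" and "A \<noteq> {}" and "compact A"
    and "regular_coeff T A \<sigma>" and "regular_coeff T A b"
    and "regular_coeff T A f" and "regular_coeff T A l"
    and "bounded (range v0)" and "\<exists>L. L-lipschitz_on UNIV v0"
    and "discretization_family T P"
    and "\<forall>(\<tau>, h)\<in>P. finite (I h)"
    and "assumption_A1 P I A M G"
    and "\<forall>(\<tau>, h)\<in>P. \<epsilon> \<tau> h > 0"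
    and "((\<lambda>(\<tau>, h). \<epsilon> \<tau> h) \<longlongrightarrow> 0) (at (0, 0) within P)"
    and "\<And>\<tau> h. uM \<tau> h = monotone_sol (I h) A (M \<tau> h) (G \<tau> h) (grid_values (I h) h v0)"
    and "\<And>\<tau> h. u \<tau> h = filtered_sol (I h) A (M \<tau> h) (G \<tau> h) (SH \<tau> h) (SH0 \<tau> h)
                          (\<epsilon> \<tau> h) \<tau> (grid_values (I h) h v0)"
  shows "(\<exists>C\<ge>0. \<forall>(\<tau>, h)\<in>P.
            max_error T \<tau> (I h) (u \<tau> h) (uM \<tau> h) \<le> T * exp (C * T) * \<epsilon> \<tau> h) \<and>
         (\<forall>v. viscosity_solution T A \<sigma> b f l v0 v \<longrightarrow>
            ((\<lambda>(\<tau>, h). max_error T \<tau> (I h) (uM \<tau> h)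
                (\<lambda>n. grid_values (I h) h (v (real n * \<tau>)))) \<longlongrightarrow> 0) (at (0, 0) within P) \<longrightarrow>
            ((\<lambda>(\<tau>, h). max_error T \<tau> (I h) (u \<tau> h)
                (\<lambda>n. grid_values (I h) h (v (real n * \<tau>)))) \<longlongrightarrow> 0) (at (0, 0) within P))"
proof -
  have fin: "finite (I h)" if "(\<tau>, h) \<in> P" for \<tau> h
    using assms(11) that by auto
  have \<tau>_pos: "0 < \<tau>" if "(\<tau>, h) \<in> P" for \<tau> h
    using assms(1,10) that by (auto simp: discretization_family_def)
  obtain C where C: "0 \<le> C"
    and closed: "\<And>\<tau> h n \<phi>. \<lbrakk>(\<tau>, h) \<in> P; \<phi> \<in> gvecs (I h)\<rbrakk> \<Longrightarrow>
      S_M (I h) A (M \<tau> h) (G \<tau> h) n \<phi> \<in> gvecs (I h)"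
    and lip: "\<And>\<tau> h n \<phi> \<psi>. \<lbrakk>(\<tau>, h) \<in> P; \<phi> \<in> gvecs (I h); \<psi> \<in> gvecs (I h)\<rbrakk> \<Longrightarrow>
      vnorm (I h) (\<lambda>i\<in>I h. S_M (I h) A (M \<tau> h) (G \<tau> h) n \<phi> i - S_M (I h) A (M \<tau> h) (G \<tau> h) n \<psi> i)
        \<le> exp (C * \<tau>) * vnorm (I h) (\<lambda>i\<in>I h. \<phi> i - \<psi> i)"
    using assumption_A1_S_M[OF assms(12,2,11)] \<tau>_pos by blast
  have error: "max_error T \<tau> (I h) (u \<tau> h) (uM \<tau> h) \<le> T * exp (C * T) * \<epsilon> \<tau> h"
    if P: "(\<tau>, h) \<in> P" for \<tau> h
    unfolding max_error_le_iff
  proof (intro allI impI)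
    fix n assume "n \<le> nsteps T \<tau>"
    then have n: "real n * \<tau> \<le> T"
      by (rule nsteps_mult_le[OF assms(1) \<tau>_pos[OF P]])
    have \<epsilon>: "0 < \<epsilon> \<tau> h" using assms(13) P by auto
    have "vnorm (I h) (\<lambda>i\<in>I h. u \<tau> h n i - uM \<tau> h n i)
        \<le> real n * \<tau> * exp (C * (real n * \<tau>)) * \<epsilon> \<tau> h"
      unfolding assms(15,16)
      by (rule filtered_sol_error[OF fin[OF P] \<epsilon> \<tau>_pos[OF P] C])
        (use closed[OF P] lip[OF P] in \<open>auto simp: grid_values_def\<close>)
    also have "\<dots> \<le> T * exp (C * T) * \<epsilon> \<tau> h"
      using n C \<tau>_pos[OF P] assms(1) \<epsilon> by (intro mult_mono) (auto intro: mult_left_mono)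
    finally show "vnorm (I h) (\<lambda>i\<in>I h. u \<tau> h n i - uM \<tau> h n i) \<le> T * exp (C * T) * \<epsilon> \<tau> h" .
  qed
  \<comment> \<open>Sandwich: the error of \<open>u\<close> against \<open>w\<close> lies between 0
    and the bound of (i) plus the error of \<open>uM\<close>, and both summands tend to 0. Here
    \<open>w\<close> stands for the grid values of \<open>v\<close>.\<close>
  have conv: "((\<lambda>(\<tau>, h). max_error T \<tau> (I h) (u \<tau> h) (w \<tau> h)) \<longlongrightarrow> 0) (at (0, 0) within P)"
    if lim: "((\<lambda>(\<tau>, h). max_error T \<tau> (I h) (uM \<tau> h) (w \<tau> h)) \<longlongrightarrow> 0) (at (0, 0) within P)" for w
  proof (rule tendsto_sandwich[OF _ _ tendsto_const])
    \<comment> \<open>The estimates are available only for pairs in \<open>P\<close>, which is all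
      that this filter sees.\<close>
    have inP: "eventually (\<lambda>p. p \<in> P) (at (0, 0) within P)"
      by (simp add: eventually_at_filter)
    show "eventually (\<lambda>p. 0 \<le> (case p of (\<tau>, h) \<Rightarrow> max_error T \<tau> (I h) (u \<tau> h) (w \<tau> h)))
        (at (0, 0) within P)"
      using inP by eventually_elim (auto simp: max_error_nonneg fin)
    show "eventually (\<lambda>p. (case p of (\<tau>, h) \<Rightarrow> max_error T \<tau> (I h) (u \<tau> h) (w \<tau> h))
        \<le> T * exp (C * T) * (case p of (\<tau>, h) \<Rightarrow> \<epsilon> \<tau> h)
          + (case p of (\<tau>, h) \<Rightarrow> max_error T \<tau> (I h) (uM \<tau> h) (w \<tau> h))) (at (0, 0) within P)"
      using inP
    proof eventually_elim
      case (elim p)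
      obtain \<tau> h where p: "p = (\<tau>, h)" by (cases p)
      then show ?case
        using error[of \<tau> h] max_error_triangle[OF fin, of \<tau> h T \<tau> "u \<tau> h" "w \<tau> h" "uM \<tau> h"] elim
        by auto
    qed
    show "((\<lambda>p. T * exp (C * T) * (case p of (\<tau>, h) \<Rightarrow> \<epsilon> \<tau> h)
        + (case p of (\<tau>, h) \<Rightarrow> max_error T \<tau> (I h) (uM \<tau> h) (w \<tau> h))) \<longlongrightarrow> 0) (at (0, 0) within P)"
      using tendsto_add[OF tendsto_mult_left[OF assms(14), of "T * exp (C * T)"] lim] by simp
  qed
  show ?thesis
  proof (intro conjI allI impI)
    show "\<exists>C\<ge>0. \<forall>(\<tau>, h)\<in>P. max_error T \<tau> (I h) (u \<tau> h) (uM \<tau> h) \<le> T * exp (C * T) * \<epsilon> \<tau> h"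
      using C error by (intro exI[of _ C]) auto
  qed (rule conv)
qed

end
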